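(* Let $\beta\ge 0$ be a real number, let $0<\mu\le 1$ and $M>0$, and let $f:S\to\mathbb{R}$ be a function on the simplex $S$ with $f\in Lip_M(\mu,S)$. Then $G_n^{\beta}(f)\in Lip_M(\mu,S)$ for all $n\in\mathbb{N}$, where $G_n^{\beta}(f)$ denotes the function $\mathbf{x}\mapsto G_n^{\beta}(f;\mathbf{x})$ on $S$.
   Context: $\mathbb{N}=\{1,2,\dots\}$ and $\mathbb{N}_0=\mathbb{N}\cup\{0\}$. The two-dimensional simplex is $S=\{\mathbf{x}=(x_1,x_2)\in\mathbb{R}^2: x_1,x_2\ge 0,\ x_1+x_2\le 1\}$. For $\mathbf{x}=(x_1,x_2)\in\mathbb{R}^2$ and $\mathbf{k}=(k_1,k_2)\in\mathbb{N}_0^2$ write $|\mathbf{x}|=x_1+x_2$, $|\mathbf{k}|=k_1+k_2$, $\mathbf{k}/n=(k_1/n,k_2/n)$, and $\binom{n}{\mathbf{k}}=\frac{n!}{k_1!\,k_2!\,(n-|\mathbf{k}|)!}$ for $|\mathbf{k}|\le n$. Bivariate (non-tensor product) Cheney-Sharma operators: for a real parameter $\beta\ge 0$, $n\in\mathbb{N}$, a continuous function $f:S\to\mathbb{R}$ and $\mathbf{x}\in S$, $$G_n^{\beta}(f;\mathbf{x})=(1+n\beta)^{1-n}\sum_{k_1=0}^{n}\sum_{k_2=0}^{n-k_1} f\left(\frac{\mathbf{k}}{n}\right)\binom{n}{\mathbf{k}}\,x_1(x_1+k_1\beta)^{k_1-1}\,x_2(x_2+k_2\beta)^{k_2-1}\,(1-|\mathbf{x}|)\left[1-|\mathbf{x}|+(n-|\mathbf{k}|)\beta\right]^{n-|\mathbf{k}|-1}.$$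 Here each factor of the form $t(t+j\beta)^{j-1}$ with $j\in\mathbb{N}_0$ and $t\ge 0$ is understood as the polynomial in $t$ it represents: it equals $1$ when $j=0$ (also at $t=0$), and it equals $t^j$ when $\beta=0$ (with $t^0=1$). Lipschitz class: for $A\subseteq\mathbb{R}^2$, $0<\mu\le 1$ and $M>0$, $Lip_M(\mu,A)$ is the set of continuous functions $f:A\to\mathbb{R}$ such that $|f(\mathbf{x})-f(\mathbf{y})|\le M\sum_{i=1}^{2}|x_i-y_i|^{\mu}$ for all $\mathbf{x},\mathbf{y}\in A$. *)

theory Defs
  imports "HOL-Analysis.Analysis"
begin

definition simplex2 :: "(real \<times> real) set"
  where "simplex2 = {(x1, x2). 0 \<le> x1 \<and> 0 \<le> x2 \<and> x1 + x2 \<le> 1}"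

definition trinomial :: "nat \<Rightarrow> nat \<Rightarrow> nat \<Rightarrow> real"
  where "trinomial n k1 k2 = fact n / (fact k1 * fact k2 * fact (n - (k1 + k2)))"

text \<open>The polynomial in \<open>t\<close> represented by \<open>t (t + j \<beta>)\<close> to the power \<open>j - 1\<close>. For \<open>j = 0\<close> it is the
  constant 1, also at \<open>t = 0\<close>. For \<open>\<beta> = 0\<close> it is \<open>t ^ j\<close>.\<close>

definition abel_factor :: "real \<Rightarrow> nat \<Rightarrow> real \<Rightarrow> real"
  where "abel_factor \<beta> j t = (if j = 0 then 1 else t * (t + real j * \<beta>) ^ (j - 1))"

definition cheney_sharma :: "nat \<Rightarrow> real \<Rightarrow> (real \<times> real \<Rightarrow> real) \<Rightarrow> real \<times> real \<Rightarrow> real"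
  where "cheney_sharma n \<beta> f = (\<lambda>(x1, x2).
    (1 + real n * \<beta>) powi (1 - int n) *
    (\<Sum>k1 = 0..n. \<Sum>k2 = 0..n - k1.
      f (real k1 / real n, real k2 / real n) * trinomial n k1 k2 *
      abel_factor \<beta> k1 x1 * abel_factor \<beta> k2 x2 *
      abel_factor \<beta> (n - (k1 + k2)) (1 - (x1 + x2))))"

text \<open>A function on \<open>A\<close> is a total function of which only the values on \<open>A\<close> matter.\<close>

definition Lip :: "real \<Rightarrow> real \<Rightarrow> (real \<times> real) set \<Rightarrow> (real \<times> real \<Rightarrow> real) set"
  where "Lip M \<mu> A = {f. continuous_on A f \<and>
    (\<forall>x\<in>A. \<forall>y\<in>A. \<bar>f x - f y\<bar> \<le>
      M * (\<bar>fst x - fst y\<bar> powr \<mu> + \<bar>snd x - snd y\<bar> powr \<mu>))}"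

end

theory Submission
  imports Defs
begin

text \<open>Up to the factor \<open>j!\<close>, the Abel factors form a sequence \<open>p\<close> of binomial type:
  \<open>p\<^sub>n(x + y) = \<Sum> p\<^sub>k(x) p\<^sub>n\<^sub>-\<^sub>k(y)\<close>. Hence the values of the operator at \<open>(x, x\<^sub>2)\<close> and
  \<open>(x + d, x\<^sub>2)\<close> can be coupled by splitting \<open>1\<close> into \<open>x, d, x\<^sub>2\<close> and a remainder, and their
  difference is at most \<open>M\<close> times the mean of \<open>(l/n)\<^sup>\<mu>\<close>, where \<open>l\<close> is the index that belongs to
  \<open>d\<close>. As \<open>l/n\<close> has mean \<open>d\<close>, concavity bounds this by \<open>M d\<^sup>\<mu>\<close>. Two points of the simplex are
  joined inside it by one step in each coordinate.\<close>

section \<open>Normalised Abel polynomials: lowering rule, addition formula and mean\<close>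

definition abel_poly :: "real \<Rightarrow> nat \<Rightarrow> real \<Rightarrow> real"
  where "abel_poly \<beta> j t = abel_factor \<beta> j t / fact j"

lemma abel_poly_0 [simp]: "abel_poly \<beta> 0 t = 1"
  by (simp add: abel_poly_def abel_factor_def)

lemma abel_poly_Suc: "abel_poly \<beta> (Suc n) t = t * (t + real (Suc n) * \<beta>) ^ n / fact (Suc n)"
  by (simp add: abel_poly_def abel_factor_def)

lemma abel_poly_at_0: "abel_poly \<beta> n 0 = (if n = 0 then 1 else 0)"
  by (simp add: abel_poly_def abel_factor_def)

lemma abel_poly_nonneg: "\<beta> \<ge> 0 \<Longrightarrow> t \<ge> 0 \<Longrightarrow> abel_poly \<beta> n t \<ge> 0"
  by (simp add: abel_poly_def abel_factor_def)

text \<open>Differentiation followed by the shift by \<open>-\<beta>\<close> lowers the index by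
  one. Together with the values at 0 this makes the normalised polynomials the basic sequence of
  that operator, and dividing by \<open>fact j\<close> keeps the rule free of constants.\<close>

lemma DERIV_abel_poly_Suc:
  "(abel_poly \<beta> (Suc n) has_real_derivative abel_poly \<beta> n (x + \<beta>)) (at x)"
proof (cases n)
  case 0
  have "abel_poly \<beta> (Suc n) = (\<lambda>t. t)"
    using 0 by (auto simp: abel_poly_Suc)
  then show ?thesis
    using 0 by simp
next
  case (Suc m)
  have *: "abel_poly \<beta> (Suc n) = (\<lambda>t. t * (t + real (Suc n) * \<beta>) ^ n / fact (Suc n))"
    by (auto simp: abel_poly_Suc)
  \<comment> \<open>The left side is the product rule. After the common \<open>m\<close>-th power is
    taken out, \<open>x + (n + 1) * \<beta>\<close> and \<open>n * x\<close> remain, and they add up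
    to \<open>(n + 1) * (x + \<beta>)\<close>.\<close>
  have "((x + real (Suc n) * \<beta>) ^ Suc m + real (Suc m) * (x + real (Suc n) * \<beta>) ^ m * x) / fact (Suc n)
      = (x + \<beta>) * (x + \<beta> + real (Suc m) * \<beta>) ^ m / fact (Suc m)"
  proof -
    have e: "x + \<beta> + real (Suc m) * \<beta> = x + real (Suc n) * \<beta>"
      by (simp add: Suc algebra_simps)
    have "((x + real (Suc n) * \<beta>) ^ Suc m + real (Suc m) * (x + real (Suc n) * \<beta>) ^ m * x)
      = real (Suc n) * ((x + \<beta>) * (x + real (Suc n) * \<beta>) ^ m)"
      by (simp add: Suc algebra_simps)
    then show ?thesis
      unfolding e by (simp add: Suc del: of_nat_Suc)
  qed
  then show ?thesis
    unfolding * unfolding Suc abel_poly_Suc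
    by (auto intro!: derivative_eq_intros simp: Suc simp del: of_nat_Suc fact_Suc power_Suc)
qed

text \<open>As functions of \<open>s\<close> both sides have the same derivative, by the induction
  hypothesis at \<open>s + \<beta>\<close>; hence \<open>s\<close> must be arbitrary in the
  induction. They agree at \<open>s = 0\<close>, where every Abel polynomial of positive index
  vanishes. The sequence \<open>q\<close> is general because the formula serves both the Abel
  polynomials and the quotients behind their mean.\<close>

lemma sheffer_addition:
  assumes q0: "\<And>x. (q 0 has_real_derivative 0) (at x)"
    and qS: "\<And>n x. (q (Suc n) has_real_derivative q n (x + \<beta>)) (at x)"
  shows "q n (x + s) = (\<Sum>k\<le>n. q k x * abel_poly \<beta> (n - k) s)"
proof (induction n arbitrary: s)
  case 0
  have "q 0 (x + s) = q 0 x"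
    using DERIV_isconst_all q0 by blast
  then show ?case by simp
next
  case (Suc n)
  define D where "D = (\<lambda>s. q (Suc n) (x + s) - (\<Sum>k\<le>Suc n. q k x * abel_poly \<beta> (Suc n - k) s))"
  \<comment> \<open>The top term is constant in \<open>s\<close> and is split off, so that every
    remaining index is a successor and the lowering rule applies.\<close>
  have D: "D = (\<lambda>s. q (Suc n) (x + s) -
      ((\<Sum>k\<le>n. q k x * abel_poly \<beta> (Suc (n - k)) s) + q (Suc n) x))"
    by (auto simp: D_def fun_eq_iff Suc_diff_le intro!: sum.cong)
  have "(D has_real_derivative 0) (at s)" for s
  proof -
    have 1: "((\<lambda>s. q (Suc n) (x + s)) has_real_derivative q n (x + s + \<beta>)) (at s)"
      using qS[of n "s + x"] DERIV_shift[of "q (Suc n)" _ s x] by (simp add: add.commute)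
    have 2: "((\<lambda>s. \<Sum>k\<le>n. q k x * abel_poly \<beta> (Suc (n - k)) s) has_real_derivative
        (\<Sum>k\<le>n. q k x * abel_poly \<beta> (n - k) (s + \<beta>))) (at s)"
      by (intro DERIV_sum DERIV_cmult DERIV_abel_poly_Suc)
    have "(D has_real_derivative q n (x + s + \<beta>)
        - ((\<Sum>k\<le>n. q k x * abel_poly \<beta> (n - k) (s + \<beta>)) + 0)) (at s)"
      unfolding D by (intro DERIV_diff DERIV_add 1 2 DERIV_const)
    then show ?thesis
      using Suc.IH[of "s + \<beta>"] by (simp add: add.assoc)
  qed
  then have "D s = D 0"
    using DERIV_isconst_all by blast
  also have "\<dots> = 0"
    by (simp add: D abel_poly_at_0)
  finally show ?case
    by (simp add: D_def)
qed

lemma abel_poly_add: "abel_poly \<beta> n (x + y) = (\<Sum>k\<le>n. abel_poly \<beta> k x * abel_poly \<beta> (n - k) y)"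
proof (rule sheffer_addition)
  have "abel_poly \<beta> 0 = (\<lambda>_. 1)"
    by auto
  then show "(abel_poly \<beta> 0 has_real_derivative 0) (at x)" for x
    by simp
qed (rule DERIV_abel_poly_Suc)

text \<open>The quotient \<open>k p\<^sub>k(t) / t\<close> is again a Sheffer sequence for the same operator.\<close>

lemma abel_poly_mean:
  "(x + y) * (\<Sum>k\<le>n. real k * (abel_poly \<beta> k x * abel_poly \<beta> (n - k) y))
    = x * (real n * abel_poly \<beta> n (x + y))"
proof -
  \<comment> \<open>The factor \<open>t\<close> is cancelled in closed form, so the quotient also
    makes sense at \<open>t = 0\<close>.\<close>
  define q where "q = (\<lambda>k t. if k = 0 then 0 else (t + real k * \<beta>) ^ (k - 1) / fact (k - 1))"
  have qt: "real k * abel_poly \<beta> k t = t * q k t" for k t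
    by (cases k) (auto simp: q_def abel_poly_Suc simp del: of_nat_Suc)
  have "q n (x + y) = (\<Sum>k\<le>n. q k x * abel_poly \<beta> (n - k) y)"
  proof (rule sheffer_addition)
    show "(q 0 has_real_derivative 0) (at x)" for x
      by (simp add: q_def)
    show "(q (Suc k) has_real_derivative q k (x + \<beta>)) (at x)" for k x
    proof (cases k)
      case 0
      then show ?thesis by (simp add: q_def)
    next
      case (Suc m)
      have e: "x + \<beta> + real (Suc m) * \<beta> = x + real (Suc k) * \<beta>"
        by (simp add: Suc algebra_simps)
      have "real (Suc m) * (x + real (Suc k) * \<beta>) ^ m / fact (Suc m)
          = (x + \<beta> + real (Suc m) * \<beta>) ^ m / fact m"
        unfolding e by (simp del: of_nat_Suc)
      then show ?thesis
        by (auto simp: q_def Suc intro!: derivative_eq_intros simp del: of_nat_Suc fact_Suc power_Suc)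
    qed
  qed
  \<comment> \<open>Multiplying the addition formula by \<open>x * (x + y)\<close> restores both
    cancelled factors without any division.\<close>
  then have "x * ((x + y) * q n (x + y))
      = (x + y) * (\<Sum>k\<le>n. (x * q k x) * abel_poly \<beta> (n - k) y)"
    by (simp add: sum_distrib_left mult.left_commute mult.assoc)
  then show ?thesis
    by (simp add: qt[symmetric] mult.assoc)
qed

section \<open>Triangular sums, coupling of weights and the concavity estimate\<close>

lemma sum_triangle:
  fixes h :: "nat \<Rightarrow> nat \<Rightarrow> 'a::comm_monoid_add"
  shows "(\<Sum>k\<le>N. \<Sum>a\<le>k. h a (k - a)) = (\<Sum>a\<le>N. \<Sum>l\<le>N - a. h a l)"
proof -
  have "(SIGMA a:{..N}. {..N - a}) = {(i, j). i + j \<le> N}"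
    by auto
  then show ?thesis
    by (simp add: sum.triangle_reindex_eq[symmetric] sum.Sigma)
qed

lemma sum_triangle_swap:
  fixes h :: "nat \<Rightarrow> nat \<Rightarrow> 'a::comm_monoid_add"
  shows "(\<Sum>a\<le>N. \<Sum>l\<le>N - a. h a l) = (\<Sum>l\<le>N. \<Sum>a\<le>N - l. h a l)"
proof -
  have "(\<Sum>a\<le>N. \<Sum>l\<le>N - a. h a l) = (\<Sum>a\<le>N. \<Sum>l | l \<in> {..N} \<and> a + l \<le> N. h a l)"
    by (intro sum.cong) auto
  also have "\<dots> = (\<Sum>l\<le>N. \<Sum>a | a \<in> {..N} \<and> a + l \<le> N. h a l)"
    by (rule sum.swap_restrict) auto
  also have "\<dots> = (\<Sum>l\<le>N. \<Sum>a\<le>N - l. h a l)"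
    by (intro sum.cong) auto
  finally show ?thesis .
qed

text \<open>In the next three lemmas the weights \<open>p\<^sub>a(x) p\<^sub>l(d) p\<^sub>m(r)\<close> with \<open>a + l + m = N\<close> are the
  common refinement of the two families of weights that are compared.\<close>

lemma abel_sum_shift_refine:
  "(\<Sum>k\<le>N. g k * (abel_poly \<beta> k (x + d) * abel_poly \<beta> (N - k) r))
    = (\<Sum>a\<le>N. \<Sum>l\<le>N - a. g (a + l) *
        (abel_poly \<beta> a x * abel_poly \<beta> l d * abel_poly \<beta> (N - (a + l)) r))"
proof -
  have "(\<Sum>a\<le>N. \<Sum>l\<le>N - a. g (a + l) *
        (abel_poly \<beta> a x * abel_poly \<beta> l d * abel_poly \<beta> (N - (a + l)) r))
    = (\<Sum>k\<le>N. \<Sum>a\<le>k. g (a + (k - a)) *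
        (abel_poly \<beta> a x * abel_poly \<beta> (k - a) d * abel_poly \<beta> (N - (a + (k - a))) r))"
    by (rule sum_triangle[symmetric])
  also have "\<dots> = (\<Sum>k\<le>N. g k * (abel_poly \<beta> k (x + d) * abel_poly \<beta> (N - k) r))"
    by (simp add: abel_poly_add sum_distrib_left sum_distrib_right)
  finally show ?thesis by simp
qed

lemma abel_sum_refine:
  "(\<Sum>a\<le>N. g a * (abel_poly \<beta> a x * abel_poly \<beta> (N - a) (d + r)))
    = (\<Sum>a\<le>N. \<Sum>l\<le>N - a. g a *
        (abel_poly \<beta> a x * abel_poly \<beta> l d * abel_poly \<beta> (N - (a + l)) r))"
  by (simp add: abel_poly_add sum_distrib_left mult.assoc)

lemma abel_sum_middle:
  "(\<Sum>a\<le>N. \<Sum>l\<le>N - a. g l *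
      (abel_poly \<beta> a x * abel_poly \<beta> l d * abel_poly \<beta> (N - (a + l)) r))
    = (\<Sum>l\<le>N. g l * (abel_poly \<beta> l d * abel_poly \<beta> (N - l) (x + r)))"
proof -
  have "N - (a + l) = N - l - a" for a l
    by simp
  then show ?thesis
    by (subst sum_triangle_swap)
      (simp add: abel_poly_add sum_distrib_left mult_ac del: diff_diff_left)
qed

text \<open>On the common refinement the first sum evaluates \<open>g\<close> at
  \<open>a + l\<close> and the second at \<open>a\<close>, under the same nonnegative weight. The
  difference is thus controlled by \<open>\<omega> l\<close>, and summing out \<open>a\<close>
  merges \<open>x\<close> with \<open>r\<close>.\<close>

lemma abel_sum_shift_bound:
  assumes "\<beta> \<ge> 0" "x \<ge> 0" "d \<ge> 0" "r \<ge> 0"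
    and g: "\<And>a l. a + l \<le> N \<Longrightarrow> \<bar>g (a + l) - g a\<bar> \<le> \<omega> l"
  shows "\<bar>(\<Sum>k\<le>N. g k * (abel_poly \<beta> k (x + d) * abel_poly \<beta> (N - k) r))
      - (\<Sum>k\<le>N. g k * (abel_poly \<beta> k x * abel_poly \<beta> (N - k) (d + r)))\<bar>
    \<le> (\<Sum>l\<le>N. \<omega> l * (abel_poly \<beta> l d * abel_poly \<beta> (N - l) (x + r)))"
proof -
  define w where "w a l = abel_poly \<beta> a x * abel_poly \<beta> l d * abel_poly \<beta> (N - (a + l)) r" for a l
  have w: "w a l \<ge> 0" for a l
    unfolding w_def using assms by (simp add: abel_poly_nonneg)
  have "\<bar>(\<Sum>a\<le>N. \<Sum>l\<le>N - a. g (a + l) * w a l) - (\<Sum>a\<le>N. \<Sum>l\<le>N - a. g a * w a l)\<bar>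
      = \<bar>\<Sum>a\<le>N. \<Sum>l\<le>N - a. (g (a + l) - g a) * w a l\<bar>"
    by (simp add: sum_subtractf left_diff_distrib)
  also have "\<dots> \<le> (\<Sum>a\<le>N. \<Sum>l\<le>N - a. \<bar>(g (a + l) - g a) * w a l\<bar>)"
    by (rule order_trans[OF sum_abs sum_mono]) (rule sum_abs)
  also have "\<dots> \<le> (\<Sum>a\<le>N. \<Sum>l\<le>N - a. \<omega> l * w a l)"
    using w g by (intro sum_mono) (auto simp: abs_mult intro!: mult_right_mono)
  finally show ?thesis
    by (simp only: abel_sum_shift_refine abel_sum_refine abel_sum_middle w_def)
qed

text \<open>This is Jensen's inequality for the concave power with exponent \<open>\<mu>\<close>:
  the weights have total mass \<open>abel_poly \<beta> n 1\<close>, and under them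
  \<open>l / n\<close> has mean \<open>d\<close>.\<close>

lemma abel_poly_jensen:
  assumes "\<beta> \<ge> 0" "0 < \<mu>" "\<mu> \<le> 1" "0 < d" "d \<le> 1" "n \<ge> 1"
  shows "(\<Sum>l\<le>n. (real l / real n) powr \<mu> * (abel_poly \<beta> l d * abel_poly \<beta> (n - l) (1 - d)))
    \<le> d powr \<mu> * abel_poly \<beta> n 1"
proof -
  define w where "w l = abel_poly \<beta> l d * abel_poly \<beta> (n - l) (1 - d)" for l
  have w: "w l \<ge> 0" for l
    unfolding w_def using assms by (simp add: abel_poly_nonneg)
  have W: "(\<Sum>l\<le>n. w l) = abel_poly \<beta> n 1"
    using abel_poly_add[of \<beta> n d "1 - d"] by (simp add: w_def)
  have "(\<Sum>l\<le>n. real l * w l) = d * (real n * abel_poly \<beta> n 1)"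
    using abel_poly_mean[of d "1 - d" \<beta> n] by (simp add: w_def)
  then have E: "(\<Sum>l\<le>n. real l / real n * w l) = d * abel_poly \<beta> n 1"
    using \<open>n \<ge> 1\<close> by (simp add: sum_divide_distrib[symmetric] field_simps)
  \<comment> \<open>Up to the factor \<open>d powr (1 - \<mu>)\<close> the right side is the tangent
    line of the power at \<open>d\<close>. Young's inequality needs positive arguments, so
    \<open>l = 0\<close> is separate.\<close>
  have young: "(real l / real n) powr \<mu> * d powr (1 - \<mu>) \<le> \<mu> * (real l / real n) + (1 - \<mu>) * d" for l
    using assms Youngs_inequality_0[of \<mu> "1 - \<mu>" "real l / real n" d] by (cases "l = 0") auto
  have "d powr (1 - \<mu>) * (\<Sum>l\<le>n. (real l / real n) powr \<mu> * w l)
      = (\<Sum>l\<le>n. ((real l / real n) powr \<mu> * d powr (1 - \<mu>)) * w l)"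
    by (simp add: sum_distrib_left mult_ac)
  also have "\<dots> \<le> (\<Sum>l\<le>n. (\<mu> * (real l / real n) + (1 - \<mu>) * d) * w l)"
    using young w by (intro sum_mono mult_right_mono) auto
  also have "\<dots> = \<mu> * (\<Sum>l\<le>n. real l / real n * w l) + (1 - \<mu>) * d * (\<Sum>l\<le>n. w l)"
    by (simp only: sum.distrib sum_distrib_left distrib_right mult.assoc)
  also have "\<dots> = d * abel_poly \<beta> n 1"
    unfolding E W by (simp add: algebra_simps)
  also have "\<dots> = d powr (1 - \<mu>) * (d powr \<mu> * abel_poly \<beta> n 1)"
    using \<open>0 < d\<close> by (simp add: mult.assoc[symmetric] powr_add[symmetric])
  finally show ?thesis
    using \<open>0 < d\<close> by (simp add: w_def)
qed

section \<open>The operator in Abel polynomials and its Lipschitz estimates\<close>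

lemma cheney_sharma_eq:
  assumes "\<beta> \<ge> 0" "n \<ge> 1"
  shows "cheney_sharma n \<beta> f (x1, x2) = (\<Sum>k2\<le>n. abel_poly \<beta> k2 x2 *
      (\<Sum>k1\<le>n - k2. f (real k1 / real n, real k2 / real n) *
        (abel_poly \<beta> k1 x1 * abel_poly \<beta> (n - k2 - k1) (1 - x1 - x2)))) / abel_poly \<beta> n 1"
proof -
  obtain m where m: "n = Suc m"
    using assms by (cases n) auto
  have "1 - int n = - int m"
    by (simp add: m)
  then have "(1 + real n * \<beta>) powi (1 - int n) = 1 / (1 + real n * \<beta>) ^ m"
    by (simp only: power_int_minus power_int_of_nat inverse_eq_divide)
  \<comment> \<open>At 1 the Abel polynomial is \<open>(1 + n * \<beta>) ^ (n - 1) / fact n\<close>.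
    Its \<open>fact n\<close> cancels against the numerator of the trinomial coefficient.\<close>
  then have c: "(1 + real n * \<beta>) powi (1 - int n) = 1 / (fact n * abel_poly \<beta> n 1)"
    unfolding m abel_poly_Suc by (simp del: of_nat_Suc fact_Suc)
  define F where "F k1 k2 = f (real k1 / real n, real k2 / real n) *
      (abel_poly \<beta> k1 x1 * abel_poly \<beta> k2 x2 * abel_poly \<beta> (n - (k1 + k2)) (1 - (x1 + x2)))" for k1 k2
  have "f (real k1 / real n, real k2 / real n) * trinomial n k1 k2 *
      abel_factor \<beta> k1 x1 * abel_factor \<beta> k2 x2 *
      abel_factor \<beta> (n - (k1 + k2)) (1 - (x1 + x2)) = fact n * F k1 k2" for k1 k2
    by (simp add: F_def trinomial_def abel_poly_def)
  then have "cheney_sharma n \<beta> f (x1, x2)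
      = (\<Sum>k1\<le>n. \<Sum>k2\<le>n - k1. F k1 k2) / abel_poly \<beta> n 1"
    by (simp add: cheney_sharma_def c atLeast0AtMost sum_distrib_left[symmetric])
  \<comment> \<open>With \<open>k2\<close> outermost, each inner sum is a one-dimensional
    convolution in the first coordinate, as in \<open>abel_sum_shift_bound\<close>.\<close>
  also have "(\<Sum>k1\<le>n. \<Sum>k2\<le>n - k1. F k1 k2) = (\<Sum>k2\<le>n. \<Sum>k1\<le>n - k2. F k1 k2)"
    by (rule sum_triangle_swap)
  finally show ?thesis
    by (simp add: F_def sum_distrib_left mult_ac diff_diff_add add.commute)
qed

lemma cheney_sharma_swap: "cheney_sharma n \<beta> (f \<circ> prod.swap) (x2, x1) = cheney_sharma n \<beta> f (x1, x2)"
  unfolding cheney_sharma_def atLeast0AtMost prod.case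
  by (subst sum_triangle_swap) (simp add: trinomial_def mult_ac add.commute)

text \<open>For each fixed \<open>k2\<close> the inner sums at the two points are coupled by the
  increment \<open>d\<close>. Summing over \<open>k2\<close> then leaves only the weights of
  \<open>d\<close> against \<open>1 - d\<close>, to which the concavity estimate applies.\<close>

lemma cheney_sharma_step_fst:
  assumes "\<beta> \<ge> 0" "0 < \<mu>" "\<mu> \<le> 1" "n \<ge> 1"
    and f: "f \<in> Lip M \<mu> simplex2"
    and S: "(x, x2) \<in> simplex2" "(y, x2) \<in> simplex2"
  shows "\<bar>cheney_sharma n \<beta> f (x, x2) - cheney_sharma n \<beta> f (y, x2)\<bar> \<le> M * \<bar>x - y\<bar> powr \<mu>"
  using S
proof (induction x y rule: linorder_wlog)
  case (sym a b)
  then show ?case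
    by (simp add: abs_minus_commute)
next
  case (le x y)
  \<comment> \<open>Equal points are set apart because \<open>abel_poly_jensen\<close> needs
    \<open>d > 0\<close>.\<close>
  then consider "x = y" | "x < y"
    by linarith
  then show ?case
  proof cases
    case 1
    then show ?thesis by simp
  next
    case 2
    define d where "d = y - x"
    define r where "r = 1 - y - x2"
    have nn: "x \<ge> 0" "d > 0" "d \<le> 1" "r \<ge> 0" "x2 \<ge> 0"
      using 2 le by (auto simp: d_def r_def simplex2_def)
    have P: "abel_poly \<beta> n 1 > 0"
      using \<open>\<beta> \<ge> 0\<close> by (auto simp: abel_poly_def abel_factor_def intro!: divide_pos_pos zero_less_power add_pos_nonneg)
    \<comment> \<open>The sign of \<open>M\<close> follows from the Lipschitz bound at two vertices
      that differ by 1 in one coordinate.\<close>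
    have "0 \<le> M"
    proof -
      have "(0, 0) \<in> simplex2" "(1, 0) \<in> simplex2"
        by (auto simp: simplex2_def)
      then have "\<bar>f (0, 0) - f (1, 0)\<bar> \<le> M"
        using f by (fastforce simp: Lip_def)
      then show ?thesis by linarith
    qed
    define \<omega> where "\<omega> l = M * (real l / real n) powr \<mu>" for l
    define A where "A z k2 = (\<Sum>k\<le>n - k2. f (real k / real n, real k2 / real n) *
        (abel_poly \<beta> k z * abel_poly \<beta> (n - k2 - k) (1 - z - x2)))" for z k2
    have A: "\<bar>A y k2 - A x k2\<bar>
        \<le> (\<Sum>l\<le>n - k2. \<omega> l * (abel_poly \<beta> l d * abel_poly \<beta> (n - k2 - l) (x + r)))"
      if "k2 \<le> n" for k2
    proof -
      have "\<bar>f (real (a + l) / real n, real k2 / real n) - f (real a / real n, real k2 / real n)\<bar> \<le> \<omega> l"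
        if "a + l \<le> n - k2" for a l
      proof -
        have "real a + real l + real k2 \<le> real n"
          using that \<open>k2 \<le> n\<close> by linarith
        then have "(real (a + l) / real n, real k2 / real n) \<in> simplex2"
          "(real a / real n, real k2 / real n) \<in> simplex2"
          using \<open>n \<ge> 1\<close> by (auto simp: simplex2_def field_simps)
        \<comment> \<open>The second coordinates agree, and \<open>0 powr \<mu>\<close> is 0, so one
          summand of the Lipschitz bound remains.\<close>
        then have "\<bar>f (real (a + l) / real n, real k2 / real n) - f (real a / real n, real k2 / real n)\<bar>
          \<le> M * \<bar>real (a + l) / real n - real a / real n\<bar> powr \<mu>"
          using f by (fastforce simp: Lip_def)
        then show ?thesis
          by (simp add: \<omega>_def diff_divide_distrib[symmetric])
      qed
      note bound = abel_sum_shift_bound[of \<beta> x d r "n - k2"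
          "\<lambda>k. f (real k / real n, real k2 / real n)" \<omega>, OF \<open>\<beta> \<ge> 0\<close> _ _ _ this]
      have e: "1 - y - x2 = r" "1 - x - x2 = d + r" "x + d = y"
        by (auto simp: d_def r_def)
      show ?thesis
        using bound nn by (simp only: A_def e less_imp_le)
    qed
    have "\<bar>(\<Sum>k2\<le>n. abel_poly \<beta> k2 x2 * A y k2) - (\<Sum>k2\<le>n. abel_poly \<beta> k2 x2 * A x k2)\<bar>
        = \<bar>\<Sum>k2\<le>n. abel_poly \<beta> k2 x2 * (A y k2 - A x k2)\<bar>"
      by (simp add: sum_subtractf right_diff_distrib)
    also have "\<dots> \<le> (\<Sum>k2\<le>n. abel_poly \<beta> k2 x2 *
        (\<Sum>l\<le>n - k2. \<omega> l * (abel_poly \<beta> l d * abel_poly \<beta> (n - k2 - l) (x + r))))"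
      using A nn \<open>\<beta> \<ge> 0\<close>
      by (intro order_trans[OF sum_abs sum_mono]) (auto simp: abs_mult abel_poly_nonneg intro!: mult_left_mono)
    also have "\<dots> = (\<Sum>k2\<le>n. \<Sum>l\<le>n - k2. \<omega> l *
        (abel_poly \<beta> k2 x2 * abel_poly \<beta> l d * abel_poly \<beta> (n - (k2 + l)) (x + r)))"
      by (simp add: sum_distrib_left mult_ac)
    \<comment> \<open>Here \<open>k2\<close> is the index summed out: \<open>x2\<close> merges with
      \<open>x + r\<close>, and the index \<open>l\<close> of \<open>d\<close> stays.\<close>
    also have "\<dots> = (\<Sum>l\<le>n. \<omega> l * (abel_poly \<beta> l d * abel_poly \<beta> (n - l) (x2 + (x + r))))"
      by (rule abel_sum_middle)
    also have "x2 + (x + r) = 1 - d"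
      by (simp add: d_def r_def)
    also have "(\<Sum>l\<le>n. \<omega> l * (abel_poly \<beta> l d * abel_poly \<beta> (n - l) (1 - d)))
        = M * (\<Sum>l\<le>n. (real l / real n) powr \<mu> * (abel_poly \<beta> l d * abel_poly \<beta> (n - l) (1 - d)))"
      by (simp add: \<omega>_def sum_distrib_left mult.assoc)
    also have "\<dots> \<le> M * (d powr \<mu> * abel_poly \<beta> n 1)"
      using \<open>0 \<le> M\<close> assms nn by (intro mult_left_mono abel_poly_jensen) auto
    finally have *: "\<bar>(\<Sum>k2\<le>n. abel_poly \<beta> k2 x2 * A y k2) - (\<Sum>k2\<le>n. abel_poly \<beta> k2 x2 * A x k2)\<bar>
        \<le> M * d powr \<mu> * abel_poly \<beta> n 1"
      by (simp add: mult.assoc)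
    have "\<bar>cheney_sharma n \<beta> f (y, x2) - cheney_sharma n \<beta> f (x, x2)\<bar>
      = \<bar>(\<Sum>k2\<le>n. abel_poly \<beta> k2 x2 * A y k2) - (\<Sum>k2\<le>n. abel_poly \<beta> k2 x2 * A x k2)\<bar> / abel_poly \<beta> n 1"
      using P unfolding cheney_sharma_eq[OF assms(1,4)] A_def
      by (simp add: diff_divide_distrib[symmetric])
    also have "\<dots> \<le> M * d powr \<mu>"
      using * P by (simp add: pos_divide_le_eq)
    finally show ?thesis
      using 2 by (simp add: d_def abs_minus_commute)
  qed
qed

lemma Lip_swap:
  assumes "f \<in> Lip M \<mu> simplex2"
  shows "f \<circ> prod.swap \<in> Lip M \<mu> simplex2"
proof -
  have S: "prod.swap ` simplex2 = simplex2"
    by (force simp: simplex2_def image_iff)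
  have "continuous_on simplex2 (f \<circ> prod.swap)"
    using assms by (intro continuous_on_compose continuous_on_swap) (auto simp: S Lip_def)
  moreover have "\<bar>f (prod.swap x) - f (prod.swap y)\<bar>
      \<le> M * (\<bar>fst x - fst y\<bar> powr \<mu> + \<bar>snd x - snd y\<bar> powr \<mu>)"
    if "x \<in> simplex2" "y \<in> simplex2" for x y
  proof -
    have "prod.swap x \<in> simplex2" "prod.swap y \<in> simplex2"
      using that S by blast+
    then have "\<bar>f (prod.swap x) - f (prod.swap y)\<bar> \<le> M * (\<bar>fst (prod.swap x) - fst (prod.swap y)\<bar> powr \<mu>
        + \<bar>snd (prod.swap x) - snd (prod.swap y)\<bar> powr \<mu>)"
      using assms unfolding Lip_def by blast
    then show ?thesis
      by (simp add: add.commute)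
  qed
  ultimately show ?thesis
    by (simp add: Lip_def)
qed

text \<open>Exchanging the coordinates preserves the simplex, the Lipschitz class and the form of
  the operator, so the estimate in the first coordinate carries over.\<close>

lemma cheney_sharma_step_snd:
  assumes "\<beta> \<ge> 0" "0 < \<mu>" "\<mu> \<le> 1" "n \<ge> 1"
    and "f \<in> Lip M \<mu> simplex2"
    and "(x1, x) \<in> simplex2" "(x1, y) \<in> simplex2"
  shows "\<bar>cheney_sharma n \<beta> f (x1, x) - cheney_sharma n \<beta> f (x1, y)\<bar> \<le> M * \<bar>x - y\<bar> powr \<mu>"
proof -
  have "(x, x1) \<in> simplex2" "(y, x1) \<in> simplex2"
    using assms(6,7) by (auto simp: simplex2_def)
  from cheney_sharma_step_fst[OF assms(1-4) Lip_swap[OF assms(5)] this] show ?thesis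
    by (simp only: cheney_sharma_swap)
qed

lemma continuous_on_cheney_sharma: "continuous_on A (cheney_sharma n \<beta> f)"
proof -
  have a: "continuous_on A (\<lambda>x. abel_factor \<beta> j (g x))" if "continuous_on A g"
    for j and g :: "real \<times> real \<Rightarrow> real"
    using that by (cases "j = 0") (auto simp: abel_factor_def intro!: continuous_intros)
  show ?thesis
    unfolding cheney_sharma_def case_prod_beta by (intro continuous_intros a)
qed

theorem theorem3:
  fixes \<beta> \<mu> M :: real and f :: "real \<times> real \<Rightarrow> real"
  assumes "\<beta> \<ge> 0"
    and "0 < \<mu>" and "\<mu> \<le> 1"
    and "M > 0"
    and "f \<in> Lip M \<mu> simplex2"
  shows "\<forall>n::nat. n \<ge> 1 \<longrightarrow> cheney_sharma n \<beta> f \<in> Lip M \<mu> simplex2"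
proof (intro allI impI)
  fix n :: nat
  assume n: "n \<ge> 1"
  note step_fst = cheney_sharma_step_fst[OF assms(1-3) n assms(5)]
  note step_snd = cheney_sharma_step_snd[OF assms(1-3) n assms(5)]
  have "\<bar>cheney_sharma n \<beta> f (x1, x2) - cheney_sharma n \<beta> f (y1, y2)\<bar>
      \<le> M * (\<bar>x1 - y1\<bar> powr \<mu> + \<bar>x2 - y2\<bar> powr \<mu>)"
    if "(x1, x2) \<in> simplex2" "(y1, y2) \<in> simplex2" for x1 x2 y1 y2
    using that
  proof (induction x1 y1 arbitrary: x2 y2 rule: linorder_wlog)
    case (sym a b)
    then show ?case
      by (metis abs_minus_commute)
  next
    case (le x1 y1)
    \<comment> \<open>With \<open>x1 \<le> y1\<close> this corner satisfies
      \<open>x1 + y2 \<le> y1 + y2 \<le> 1\<close>, while the opposite corner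
      \<open>(y1, x2)\<close> may lie outside the simplex.\<close>
    then have "(x1, y2) \<in> simplex2"
      by (auto simp: simplex2_def)
    with step_snd[of x1 x2 y2] step_fst[of x1 y2 y1] le show ?case
      by (simp add: distrib_left)
  qed
  then show "cheney_sharma n \<beta> f \<in> Lip M \<mu> simplex2"
    by (simp add: Lip_def continuous_on_cheney_sharma split_paired_all)
qed

end
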